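(* For every basis $\Gamma$, computations $M,N$ of $\lambda_c^u$ and computation type $\tau$: if $\Gamma\vdash M:\tau$ and $M\longrightarrow N$, then $\Gamma\vdash N:\tau$.
   Context: Syntax of $\lambda_c^u$: values $V ::= x\mid \lambda x.M$, computations $M ::= \mathit{unit}\,V\mid M\star V$. One-step reduction $\longrightarrow$ is the closure under all (value/computation) contexts of the rules $\mathit{unit}\,V\star(\lambda x.M)\to M[V/x]$, $M\star\lambda x.\mathit{unit}\,x\to M$, and $(L\star\lambda x.M)\star\lambda y.N\to L\star\lambda x.(M\star\lambda y.N)$ for $x\notin FV(N)$. Types: value types $\delta ::= \alpha\mid \delta\to\tau\mid \delta\wedge\delta\mid \omega_{\mathsf V}$, computation types $\tau ::= T\delta\mid \tau\wedge\tau\mid \omega_{\mathsf C}$. The preorders $\le_{\mathsf V},\le_{\mathsf C}$ are the least preorders such that, for each sort, $\omega$ is top, $\wedge$ is monotone, idempotent and commutative, $\sigma\wedge\sigma'\le\sigma$, and $\sigma\le\sigma',\sigma\le\sigma''\Rightarrow\sigma\le\sigma'\wedge\sigma''$; moreover $\omega_{\mathsf V}\le_{\mathsf V}\omega_{\mathsf V}\to\omega_{\mathsf C}$, $(\delta\to\tau)\wedge(\delta\to\tau')\le_{\mathsf V}\delta\to(\tau\wedge\tau')$, $\delta'\le_{\mathsf V}\delta,\tau\le_{\mathsf C}\tau'\Rightarrow\delta\to\tau\le_{\mathsf V}\delta'\to\tau'$, $T\delta\wedge T\delta'\le_{\mathsf C}T(\delta\wedge\delta')$, $\delta\le_{\mathsf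 V}\delta'\Rightarrow T\delta\le_{\mathsf C}T\delta'$. A basis is a finite set of assumptions $x_i:\delta_i$ with distinct variables. Typing rules: (Ax) $x:\delta\in\Gamma\Rightarrow\Gamma\vdash x:\delta$; ($\to$I) $\Gamma,x:\delta\vdash M:\tau\Rightarrow\Gamma\vdash\lambda x.M:\delta\to\tau$; (unit I) $\Gamma\vdash V:\delta\Rightarrow\Gamma\vdash\mathit{unit}\,V:T\delta$; ($\to$E) $\Gamma\vdash M:T\delta,\ \Gamma\vdash V:\delta\to\tau\Rightarrow\Gamma\vdash M\star V:\tau$; and for each sort: ($\omega$) $\Gamma\vdash P:\omega$; ($\wedge$I) from $\Gamma\vdash P:\sigma$ and $\Gamma\vdash P:\sigma'$ infer $\Gamma\vdash P:\sigma\wedge\sigma'$; ($\le$) from $\Gamma\vdash P:\sigma$ and $\sigma\le\sigma'$ infer $\Gamma\vdash P:\sigma'$. *)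

theory Defs
  imports Main
begin

text \<open>
  Terms are taken modulo renaming of bound variables, by de Bruijn indices: the occurrence
  \<open>Var i\<close> under \<open>k\<close> binders is bound if \<open>i < k\<close>, and otherwise is the free variable number
  \<open>i - k\<close>.
\<close>

datatype val = Var nat | Lam cmp
  and cmp = Unit val | Bind cmp val (infixl "\<star>" 70)

primrec lift_val :: "nat \<Rightarrow> val \<Rightarrow> val" and lift_cmp :: "nat \<Rightarrow> cmp \<Rightarrow> cmp" where
  "lift_val k (Var i) = (if i < k then Var i else Var (Suc i))"
| "lift_val k (Lam M) = Lam (lift_cmp (Suc k) M)"
| "lift_cmp k (Unit V) = Unit (lift_val k V)"
| "lift_cmp k (M \<star> V) = lift_cmp k M \<star> lift_val k V"

text \<open>
  \<open>subst_cmp M W k\<close> replaces index \<open>k\<close> by \<open>W\<close> and removes the binder it referred to, so the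
  indices above \<open>k\<close> are decremented. In particular, the contractum of
  \<open>Unit V \<star> Lam M\<close>, the paper's \<open>M[V/x]\<close>, is \<open>subst_cmp M V 0\<close>.
\<close>

primrec subst_val :: "val \<Rightarrow> val \<Rightarrow> nat \<Rightarrow> val" and subst_cmp :: "cmp \<Rightarrow> val \<Rightarrow> nat \<Rightarrow> cmp" where
  "subst_val (Var i) W k = (if k < i then Var (i - 1) else if i = k then W else Var i)"
| "subst_val (Lam M) W k = Lam (subst_cmp M (lift_val 0 W) (Suc k))"
| "subst_cmp (Unit V) W k = Unit (subst_val V W k)"
| "subst_cmp (M \<star> V) W k = subst_cmp M W k \<star> subst_val V W k"

text \<open>
  In \<open>assoc\<close>, \<open>N\<close> is moved under the binder of \<open>x\<close>; lifting its indices from \<open>1\<close> upwards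
  (index \<open>0\<close> is its own bound \<open>y\<close>) expresses the side condition that \<open>x\<close> is not free in \<open>N\<close>.
\<close>

inductive contract :: "cmp \<Rightarrow> cmp \<Rightarrow> bool" where
  beta: "contract (Unit V \<star> Lam M) (subst_cmp M V 0)"
| ident: "contract (M \<star> Lam (Unit (Var 0))) M"
| assoc: "contract ((L \<star> Lam M) \<star> Lam N) (L \<star> Lam (M \<star> Lam (lift_cmp 1 N)))"

inductive red_val :: "val \<Rightarrow> val \<Rightarrow> bool" (infix "\<longrightarrow>\<^sub>V" 50)
  and red_cmp :: "cmp \<Rightarrow> cmp \<Rightarrow> bool" (infix "\<longrightarrow>\<^sub>C" 50) where
  Contract: "contract M N \<Longrightarrow> M \<longrightarrow>\<^sub>C N"
| Lam: "M \<longrightarrow>\<^sub>C N \<Longrightarrow> Lam M \<longrightarrow>\<^sub>V Lam N"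
| Unit: "V \<longrightarrow>\<^sub>V W \<Longrightarrow> Unit V \<longrightarrow>\<^sub>C Unit W"
| BindL: "M \<longrightarrow>\<^sub>C N \<Longrightarrow> M \<star> V \<longrightarrow>\<^sub>C N \<star> V"
| BindR: "V \<longrightarrow>\<^sub>V W \<Longrightarrow> M \<star> V \<longrightarrow>\<^sub>C M \<star> W"

text \<open>The parameter \<open>'a\<close> is the set of atomic value types.\<close>

datatype 'a vty = Atom 'a
  | Arrow "'a vty" "'a cty" (infixr "\<rightarrow>\<^sub>V" 60)
  | InterV "'a vty" "'a vty" (infixl "\<and>\<^sub>V" 65)
  | OmegaV ("\<omega>\<^sub>V")
and 'a cty = T "'a vty"
  | InterC "'a cty" "'a cty" (infixl "\<and>\<^sub>C" 65)
  | OmegaC ("\<omega>\<^sub>C")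

inductive le_vty :: "'a vty \<Rightarrow> 'a vty \<Rightarrow> bool" (infix "\<le>\<^sub>V" 50)
  and le_cty :: "'a cty \<Rightarrow> 'a cty \<Rightarrow> bool" (infix "\<le>\<^sub>C" 50) where
  reflV: "\<delta> \<le>\<^sub>V \<delta>"
| transV: "\<delta> \<le>\<^sub>V \<delta>' \<Longrightarrow> \<delta>' \<le>\<^sub>V \<delta>'' \<Longrightarrow> \<delta> \<le>\<^sub>V \<delta>''"
| topV: "\<delta> \<le>\<^sub>V \<omega>\<^sub>V"
| monoV: "\<delta>1 \<le>\<^sub>V \<delta>1' \<Longrightarrow> \<delta>2 \<le>\<^sub>V \<delta>2' \<Longrightarrow> \<delta>1 \<and>\<^sub>V \<delta>2 \<le>\<^sub>V \<delta>1' \<and>\<^sub>V \<delta>2'"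
| idemV: "\<delta> \<le>\<^sub>V \<delta> \<and>\<^sub>V \<delta>"
| commV: "\<delta> \<and>\<^sub>V \<delta>' \<le>\<^sub>V \<delta>' \<and>\<^sub>V \<delta>"
| lowerV: "\<delta> \<and>\<^sub>V \<delta>' \<le>\<^sub>V \<delta>"
| greatestV: "\<delta> \<le>\<^sub>V \<delta>' \<Longrightarrow> \<delta> \<le>\<^sub>V \<delta>'' \<Longrightarrow> \<delta> \<le>\<^sub>V \<delta>' \<and>\<^sub>V \<delta>''"
| omega_arrow: "\<omega>\<^sub>V \<le>\<^sub>V \<omega>\<^sub>V \<rightarrow>\<^sub>V \<omega>\<^sub>C"
| inter_arrow: "(\<delta> \<rightarrow>\<^sub>V \<tau>) \<and>\<^sub>V (\<delta> \<rightarrow>\<^sub>V \<tau>') \<le>\<^sub>V \<delta> \<rightarrow>\<^sub>V (\<tau> \<and>\<^sub>C \<tau>')"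
| arrow: "\<delta>' \<le>\<^sub>V \<delta> \<Longrightarrow> \<tau> \<le>\<^sub>C \<tau>' \<Longrightarrow> \<delta> \<rightarrow>\<^sub>V \<tau> \<le>\<^sub>V \<delta>' \<rightarrow>\<^sub>V \<tau>'"
| reflC: "\<tau> \<le>\<^sub>C \<tau>"
| transC: "\<tau> \<le>\<^sub>C \<tau>' \<Longrightarrow> \<tau>' \<le>\<^sub>C \<tau>'' \<Longrightarrow> \<tau> \<le>\<^sub>C \<tau>''"
| topC: "\<tau> \<le>\<^sub>C \<omega>\<^sub>C"
| monoC: "\<tau>1 \<le>\<^sub>C \<tau>1' \<Longrightarrow> \<tau>2 \<le>\<^sub>C \<tau>2' \<Longrightarrow> \<tau>1 \<and>\<^sub>C \<tau>2 \<le>\<^sub>C \<tau>1' \<and>\<^sub>C \<tau>2'"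
| idemC: "\<tau> \<le>\<^sub>C \<tau> \<and>\<^sub>C \<tau>"
| commC: "\<tau> \<and>\<^sub>C \<tau>' \<le>\<^sub>C \<tau>' \<and>\<^sub>C \<tau>"
| lowerC: "\<tau> \<and>\<^sub>C \<tau>' \<le>\<^sub>C \<tau>"
| greatestC: "\<tau> \<le>\<^sub>C \<tau>' \<Longrightarrow> \<tau> \<le>\<^sub>C \<tau>'' \<Longrightarrow> \<tau> \<le>\<^sub>C \<tau>' \<and>\<^sub>C \<tau>''"
| inter_T: "T \<delta> \<and>\<^sub>C T \<delta>' \<le>\<^sub>C T (\<delta> \<and>\<^sub>V \<delta>')"
| mono_T: "\<delta> \<le>\<^sub>V \<delta>' \<Longrightarrow> T \<delta> \<le>\<^sub>C T \<delta>'"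

text \<open>
  A basis is a finite partial map from free variables to value types. A map rather than a list:
  by the rules for \<open>\<omega>\<close>, a typable term may have free variables on which the basis is undefined.
\<close>

definition basis :: "(nat \<rightharpoonup> 'a vty) \<Rightarrow> bool" where
  "basis \<Gamma> \<longleftrightarrow> finite (dom \<Gamma>)"

text \<open>
  \<open>\<Gamma>, x : \<delta>\<close> for a fresh \<open>x\<close>: in the body of the abstraction, \<open>x\<close> is index \<open>0\<close> and free variable
  \<open>i\<close> is index \<open>Suc i\<close>.
\<close>

definition extend :: "(nat \<rightharpoonup> 'a vty) \<Rightarrow> 'a vty \<Rightarrow> (nat \<rightharpoonup> 'a vty)" where
  "extend \<Gamma> \<delta> = (\<lambda>n. case n of 0 \<Rightarrow> Some \<delta> | Suc i \<Rightarrow> \<Gamma> i)"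

inductive type_val :: "(nat \<rightharpoonup> 'a vty) \<Rightarrow> val \<Rightarrow> 'a vty \<Rightarrow> bool" ("_ \<turnstile>\<^sub>V _ : _" [50, 50, 50] 50)
  and type_cmp :: "(nat \<rightharpoonup> 'a vty) \<Rightarrow> cmp \<Rightarrow> 'a cty \<Rightarrow> bool" ("_ \<turnstile>\<^sub>C _ : _" [50, 50, 50] 50) where
  Ax: "\<Gamma> x = Some \<delta> \<Longrightarrow> \<Gamma> \<turnstile>\<^sub>V Var x : \<delta>"
| ArrowI: "extend \<Gamma> \<delta> \<turnstile>\<^sub>C M : \<tau> \<Longrightarrow> \<Gamma> \<turnstile>\<^sub>V Lam M : \<delta> \<rightarrow>\<^sub>V \<tau>"
| UnitI: "\<Gamma> \<turnstile>\<^sub>V V : \<delta> \<Longrightarrow> \<Gamma> \<turnstile>\<^sub>C Unit V : T \<delta>"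
| ArrowE: "\<Gamma> \<turnstile>\<^sub>C M : T \<delta> \<Longrightarrow> \<Gamma> \<turnstile>\<^sub>V V : \<delta> \<rightarrow>\<^sub>V \<tau> \<Longrightarrow> \<Gamma> \<turnstile>\<^sub>C M \<star> V : \<tau>"
| OmegaV: "\<Gamma> \<turnstile>\<^sub>V V : \<omega>\<^sub>V"
| OmegaC: "\<Gamma> \<turnstile>\<^sub>C M : \<omega>\<^sub>C"
| InterVI: "\<Gamma> \<turnstile>\<^sub>V V : \<delta> \<Longrightarrow> \<Gamma> \<turnstile>\<^sub>V V : \<delta>' \<Longrightarrow> \<Gamma> \<turnstile>\<^sub>V V : \<delta> \<and>\<^sub>V \<delta>'"
| InterCI: "\<Gamma> \<turnstile>\<^sub>C M : \<tau> \<Longrightarrow> \<Gamma> \<turnstile>\<^sub>C M : \<tau>' \<Longrightarrow> \<Gamma> \<turnstile>\<^sub>C M : \<tau> \<and>\<^sub>C \<tau>'"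
| SubV: "\<Gamma> \<turnstile>\<^sub>V V : \<delta> \<Longrightarrow> \<delta> \<le>\<^sub>V \<delta>' \<Longrightarrow> \<Gamma> \<turnstile>\<^sub>V V : \<delta>'"
| SubC: "\<Gamma> \<turnstile>\<^sub>C M : \<tau> \<Longrightarrow> \<tau> \<le>\<^sub>C \<tau>' \<Longrightarrow> \<Gamma> \<turnstile>\<^sub>C M : \<tau>'"

end

theory Submission
  imports Defs
begin

text \<open>
  Subtyping is never inverted syntactically. For each term constructor, the types it can receive
  are described by a predicate recursive in the type (intersection as conjunction, \<open>\<omega>\<close> as truth),
  which is checked to be upward closed under \<open>\<le>\<close>. The associativity rule also needs
  that \<open>\<omega>\<^sub>C\<close> lies below no \<open>T \<delta>\<close>: a bind can have a type above \<open>\<omega>\<^sub>C\<close> without its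
  components having any other type.
\<close>

section \<open>Weakening and substitution\<close>

lemma extend_simps [simp]:
  "extend \<Gamma> \<delta> 0 = Some \<delta>" "extend \<Gamma> \<delta> (Suc i) = \<Gamma> i"
  by (simp_all add: extend_def)

text \<open>Induction on the derivation, with \<open>SubV\<close> repairing each axiom. As \<Gamma>'
  may be defined on further variables, this covers weakening as well as strengthened
  assumptions.\<close>

lemma narrowing:
  "\<Gamma> \<turnstile>\<^sub>V V : \<sigma> \<Longrightarrow> (\<And>i \<delta>. \<Gamma> i = Some \<delta> \<Longrightarrow> \<exists>\<delta>'. \<Gamma>' i = Some \<delta>' \<and> \<delta>' \<le>\<^sub>V \<delta>) \<Longrightarrow> \<Gamma>' \<turnstile>\<^sub>V V : \<sigma>"
  "\<Gamma> \<turnstile>\<^sub>C M : \<tau> \<Longrightarrow> (\<And>i \<delta>. \<Gamma> i = Some \<delta> \<Longrightarrow> \<exists>\<delta>'. \<Gamma>' i = Some \<delta>' \<and> \<delta>' \<le>\<^sub>V \<delta>) \<Longrightarrow> \<Gamma>' \<turnstile>\<^sub>C M : \<tau>"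
proof (induction arbitrary: \<Gamma>' and \<Gamma>' rule: type_val_type_cmp.inducts)
  case (Ax \<Gamma> x \<delta>)
  then show ?case by (meson SubV type_val_type_cmp.Ax)
next
  case (ArrowI \<Gamma> \<delta> M \<tau>)
  have "extend \<Gamma>' \<delta> \<turnstile>\<^sub>C M : \<tau>"
  proof (rule ArrowI.IH)
    fix i \<sigma> assume "extend \<Gamma> \<delta> i = Some \<sigma>"
    then show "\<exists>\<delta>'. extend \<Gamma>' \<delta> i = Some \<delta>' \<and> \<delta>' \<le>\<^sub>V \<sigma>"
      using ArrowI.prems by (cases i) (auto intro: reflV)
  qed
  then show ?case by (rule type_val_type_cmp.ArrowI)
qed (blast intro: type_val_type_cmp.intros)+

lemma narrowing_extend:
  assumes "extend \<Gamma> \<delta> \<turnstile>\<^sub>C M : \<tau>" "\<delta>' \<le>\<^sub>V \<delta>"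
  shows "extend \<Gamma> \<delta>' \<turnstile>\<^sub>C M : \<tau>"
  using assms(1)
proof (rule narrowing(2))
  fix i \<sigma> assume "extend \<Gamma> \<delta> i = Some \<sigma>"
  then show "\<exists>\<sigma>'. extend \<Gamma> \<delta>' i = Some \<sigma>' \<and> \<sigma>' \<le>\<^sub>V \<sigma>"
    using assms(2) by (cases i) (auto intro: reflV)
qed

text \<open>The cutoff \<open>k\<close> is general because passing a binder raises it by one. The
  hypothesis leaves \<Gamma>' free at \<open>k\<close>, the index of the inserted variable.\<close>

lemma type_lift:
  "\<Gamma> \<turnstile>\<^sub>V V : \<sigma> \<Longrightarrow> (\<And>i \<delta>. \<Gamma> i = Some \<delta> \<Longrightarrow> \<Gamma>' (if i < k then i else Suc i) = Some \<delta>) \<Longrightarrow>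
    \<Gamma>' \<turnstile>\<^sub>V lift_val k V : \<sigma>"
  "\<Gamma> \<turnstile>\<^sub>C M : \<tau> \<Longrightarrow> (\<And>i \<delta>. \<Gamma> i = Some \<delta> \<Longrightarrow> \<Gamma>' (if i < k then i else Suc i) = Some \<delta>) \<Longrightarrow>
    \<Gamma>' \<turnstile>\<^sub>C lift_cmp k M : \<tau>"
proof (induction arbitrary: \<Gamma>' k and \<Gamma>' k rule: type_val_type_cmp.inducts)
  case (Ax \<Gamma> x \<delta>)
  from Ax(2)[OF Ax(1)] show ?case by (auto intro: type_val_type_cmp.Ax)
next
  case (ArrowI \<Gamma> \<delta> M \<tau>)
  have "extend \<Gamma>' \<delta> \<turnstile>\<^sub>C lift_cmp (Suc k) M : \<tau>"
  proof (rule ArrowI.IH)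
    fix i \<sigma> assume "extend \<Gamma> \<delta> i = Some \<sigma>"
    then show "extend \<Gamma>' \<delta> (if i < Suc k then i else Suc i) = Some \<sigma>"
      \<comment> \<open>Index \<open>0\<close> is the new binder on both sides; a positive
        \<open>i\<close> is index \<open>i - 1\<close> of \<Gamma>.\<close>
      using ArrowI.prems[of "i - 1"] by (cases i) (auto split: if_splits)
  qed
  then show ?case by (auto intro: type_val_type_cmp.ArrowI)
next
  case (ArrowE \<Gamma> M \<delta> V \<tau>)
  have "\<Gamma>' \<turnstile>\<^sub>C lift_cmp k M : T \<delta>" "\<Gamma>' \<turnstile>\<^sub>V lift_val k V : \<delta> \<rightarrow>\<^sub>V \<tau>"
    using ArrowE by blast+
  then show ?case by (auto intro: type_val_type_cmp.ArrowE)
next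
  case (UnitI \<Gamma> V \<delta>)
  have "\<Gamma>' \<turnstile>\<^sub>V lift_val k V : \<delta>" using UnitI by blast
  then show ?case by (auto intro: type_val_type_cmp.UnitI)
qed (blast intro: type_val_type_cmp.intros)+

text \<open>Stating the hypothesis through \<open>subst_val (Var i) W k\<close> treats indices
  below, at and above \<open>k\<close> uniformly and turns the axiom case into the hypothesis
  itself.\<close>

lemma type_subst:
  "\<Gamma> \<turnstile>\<^sub>V V : \<sigma> \<Longrightarrow> (\<And>i \<delta>. \<Gamma> i = Some \<delta> \<Longrightarrow> \<Gamma>' \<turnstile>\<^sub>V subst_val (Var i) W k : \<delta>) \<Longrightarrow>
    \<Gamma>' \<turnstile>\<^sub>V subst_val V W k : \<sigma>"
  "\<Gamma> \<turnstile>\<^sub>C M : \<tau> \<Longrightarrow> (\<And>i \<delta>. \<Gamma> i = Some \<delta> \<Longrightarrow> \<Gamma>' \<turnstile>\<^sub>V subst_val (Var i) W k : \<delta>) \<Longrightarrow>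
    \<Gamma>' \<turnstile>\<^sub>C subst_cmp M W k : \<tau>"
proof (induction arbitrary: \<Gamma>' W k and \<Gamma>' W k rule: type_val_type_cmp.inducts)
  case (Ax \<Gamma> x \<delta>)
  then show ?case by blast
next
  case (ArrowI \<Gamma> \<delta> M \<tau>)
  have "extend \<Gamma>' \<delta> \<turnstile>\<^sub>C subst_cmp M (lift_val 0 W) (Suc k) : \<tau>"
  proof (rule ArrowI.IH)
    fix i \<sigma> assume i: "extend \<Gamma> \<delta> i = Some \<sigma>"
    show "extend \<Gamma>' \<delta> \<turnstile>\<^sub>V subst_val (Var i) (lift_val 0 W) (Suc k) : \<sigma>"
    proof (cases i)
      case 0
      with i show ?thesis by (auto intro: Ax)
    next
      case (Suc j)
      with i have "\<Gamma>' \<turnstile>\<^sub>V subst_val (Var j) W k : \<sigma>" by (intro ArrowI.prems) simp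
      then have "extend \<Gamma>' \<delta> \<turnstile>\<^sub>V lift_val 0 (subst_val (Var j) W k) : \<sigma>"
        by (rule type_lift(1)) simp
      \<comment> \<open>Lifting is commuted with substitution on a variable only, where comparing
        indices suffices.\<close>
      moreover have "lift_val 0 (subst_val (Var j) W k) = subst_val (Var i) (lift_val 0 W) (Suc k)"
        using Suc by auto
      ultimately show ?thesis by metis
    qed
  qed
  then show ?case by (auto intro: type_val_type_cmp.ArrowI)
next
  case (ArrowE \<Gamma> M \<delta> V \<tau>)
  have "\<Gamma>' \<turnstile>\<^sub>C subst_cmp M W k : T \<delta>" "\<Gamma>' \<turnstile>\<^sub>V subst_val V W k : \<delta> \<rightarrow>\<^sub>V \<tau>"
    using ArrowE by blast+
  then show ?case by (auto intro: type_val_type_cmp.ArrowE)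
next
  case (UnitI \<Gamma> V \<delta>)
  have "\<Gamma>' \<turnstile>\<^sub>V subst_val V W k : \<delta>" using UnitI by blast
  then show ?case by (auto intro: type_val_type_cmp.UnitI)
qed (blast intro: type_val_type_cmp.intros)+

lemma type_beta:
  assumes "extend \<Gamma> \<delta> \<turnstile>\<^sub>C M : \<tau>" "\<Gamma> \<turnstile>\<^sub>V V : \<delta>"
  shows "\<Gamma> \<turnstile>\<^sub>C subst_cmp M V 0 : \<tau>"
  using assms(1)
proof (rule type_subst(2))
  fix i \<sigma> assume "extend \<Gamma> \<delta> i = Some \<sigma>"
  then show "\<Gamma> \<turnstile>\<^sub>V subst_val (Var i) V 0 : \<sigma>"
    using assms(2) by (cases i) (auto intro: Ax)
qed

section \<open>Generation\<close>

primrec omega_like :: "'a cty \<Rightarrow> bool" where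
  "omega_like (T \<delta>) = False"
| "omega_like (\<tau> \<and>\<^sub>C \<tau>') = (omega_like \<tau> \<and> omega_like \<tau>')"
| "omega_like \<omega>\<^sub>C = True"

text \<open>The rules with a type \<open>T \<delta>\<close> on the right, \<open>inter_T\<close> and
  \<open>mono_T\<close>, have a left side that is not \<open>omega_like\<close>, so they preserve
  the predicate vacuously.\<close>

lemma omega_like_mono: "\<tau> \<le>\<^sub>C \<tau>' \<Longrightarrow> omega_like \<tau> \<Longrightarrow> omega_like \<tau>'"
  by (induction rule: le_vty_le_cty.inducts(2)[where ?P1.0 = "\<lambda>_ _. True"]) auto

lemma omega_not_le_T: "\<not> \<omega>\<^sub>C \<le>\<^sub>C T \<delta>"
  using omega_like_mono by fastforce

text \<open>\<open>P \<delta> \<tau>\<close> stands for "the body has type \<tau> when the bound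
  variable has type \<delta>". Atoms are false because no abstraction receives an atomic
  type.\<close>

primrec lam_has :: "('a vty \<Rightarrow> 'a cty \<Rightarrow> bool) \<Rightarrow> 'a vty \<Rightarrow> bool" where
  "lam_has P (Atom a) = False"
| "lam_has P (\<delta> \<rightarrow>\<^sub>V \<tau>) = P \<delta> \<tau>"
| "lam_has P (\<delta> \<and>\<^sub>V \<delta>') = (lam_has P \<delta> \<and> lam_has P \<delta>')"
| "lam_has P \<omega>\<^sub>V = True"

text \<open>Each arrow axiom is matched by a typing principle for the body:
  \<open>omega_arrow\<close> by \<open>OmegaC\<close>, \<open>inter_arrow\<close> by
  \<open>InterCI\<close>, \<open>arrow\<close> by narrowing and \<open>SubC\<close>.\<close>

lemma lam_has_mono:
  "\<delta> \<le>\<^sub>V \<delta>' \<Longrightarrow> lam_has (\<lambda>\<delta> \<tau>. extend \<Gamma> \<delta> \<turnstile>\<^sub>C M : \<tau>) \<delta> \<Longrightarrow> lam_has (\<lambda>\<delta> \<tau>. extend \<Gamma> \<delta> \<turnstile>\<^sub>C M : \<tau>) \<delta>'"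
  by (induction rule: le_vty_le_cty.inducts(1)[where ?P2.0 = "\<lambda>_ _. True"])
     (auto intro: OmegaC InterCI SubC narrowing_extend)

lemma type_Lam_iff:
  "\<Gamma> \<turnstile>\<^sub>V Lam M : \<delta> \<longleftrightarrow> lam_has (\<lambda>\<delta> \<tau>. extend \<Gamma> \<delta> \<turnstile>\<^sub>C M : \<tau>) \<delta>"
proof
  assume "\<Gamma> \<turnstile>\<^sub>V Lam M : \<delta>"
  then show "lam_has (\<lambda>\<delta> \<tau>. extend \<Gamma> \<delta> \<turnstile>\<^sub>C M : \<tau>) \<delta>"
    by (induction \<Gamma> "Lam M" \<delta>
        rule: type_val_type_cmp.inducts(1)[where ?P2.0 = "\<lambda>_ _ _. True"])
       (auto intro: lam_has_mono)
next
  show "lam_has (\<lambda>\<delta> \<tau>. extend \<Gamma> \<delta> \<turnstile>\<^sub>C M : \<tau>) \<delta> \<Longrightarrow> \<Gamma> \<turnstile>\<^sub>V Lam M : \<delta>"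
    by (induction \<delta> rule: vty.induct[where ?P2.0 = "\<lambda>_. True"])
       (auto intro: ArrowI InterVI OmegaV)
qed

text \<open>At an arrow, \<open>lam_has\<close> is its predicate argument, so the inversion is exact
  despite \<open>SubV\<close> and \<open>InterVI\<close>.\<close>

corollary type_Lam_Arrow: "\<Gamma> \<turnstile>\<^sub>V Lam M : \<delta> \<rightarrow>\<^sub>V \<tau> \<longleftrightarrow> extend \<Gamma> \<delta> \<turnstile>\<^sub>C M : \<tau>"
  by (simp add: type_Lam_iff)

primrec unit_has :: "('a vty \<Rightarrow> bool) \<Rightarrow> 'a cty \<Rightarrow> bool" where
  "unit_has P (T \<delta>) = P \<delta>"
| "unit_has P (\<tau> \<and>\<^sub>C \<tau>') = (unit_has P \<tau> \<and> unit_has P \<tau>')"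
| "unit_has P \<omega>\<^sub>C = True"

text \<open>Here \<open>inter_T\<close> is matched by \<open>InterVI\<close> and
  \<open>mono_T\<close> by \<open>SubV\<close>.\<close>

lemma unit_has_mono:
  "\<tau> \<le>\<^sub>C \<tau>' \<Longrightarrow> unit_has (type_val \<Gamma> V) \<tau> \<Longrightarrow> unit_has (type_val \<Gamma> V) \<tau>'"
  by (induction rule: le_vty_le_cty.inducts(2)[where ?P1.0 = "\<lambda>_ _. True"])
     (auto intro: InterVI SubV)

lemma type_Unit_iff: "\<Gamma> \<turnstile>\<^sub>C Unit V : \<tau> \<longleftrightarrow> unit_has (type_val \<Gamma> V) \<tau>"
proof
  assume "\<Gamma> \<turnstile>\<^sub>C Unit V : \<tau>"
  then show "unit_has (type_val \<Gamma> V) \<tau>"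
    by (induction \<Gamma> "Unit V" \<tau>
        rule: type_val_type_cmp.inducts(2)[where ?P1.0 = "\<lambda>_ _ _. True"])
       (auto intro: unit_has_mono)
next
  show "unit_has (type_val \<Gamma> V) \<tau> \<Longrightarrow> \<Gamma> \<turnstile>\<^sub>C Unit V : \<tau>"
    by (induction \<tau> rule: cty.induct[where ?P1.0 = "\<lambda>_. True"])
       (auto intro: UnitI InterCI OmegaC)
qed

corollary type_Unit_T: "\<Gamma> \<turnstile>\<^sub>C Unit V : T \<delta> \<longleftrightarrow> \<Gamma> \<turnstile>\<^sub>V V : \<delta>"
  by (simp add: type_Unit_iff)

lemma type_Var:
  assumes "\<Gamma> \<turnstile>\<^sub>V Var x : \<sigma>" "\<Gamma> x = Some \<delta>"
  shows "\<delta> \<le>\<^sub>V \<sigma>"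
  using assms
  by (induction \<Gamma> "Var x" \<sigma>
      rule: type_val_type_cmp.inducts(1)[where ?P2.0 = "\<lambda>_ _ _. True"])
     (auto intro: reflV topV greatestV transV)

lemma type_Unit_Var:
  assumes "\<Gamma> \<turnstile>\<^sub>C Unit (Var x) : \<tau>" "\<Gamma> x = Some \<delta>"
  shows "T \<delta> \<le>\<^sub>C \<tau>"
proof -
  have "unit_has (type_val \<Gamma> (Var x)) \<tau>" using assms(1) by (simp add: type_Unit_iff)
  then show ?thesis
    by (induction \<tau> rule: cty.induct[where ?P1.0 = "\<lambda>_. True"])
       (auto intro: mono_T topC greatestC type_Var[where x = x] assms(2))
qed

lemma arrow_mono_right: "\<Gamma> \<turnstile>\<^sub>V V : \<delta> \<rightarrow>\<^sub>V \<tau> \<Longrightarrow> \<tau> \<le>\<^sub>C \<tau>' \<Longrightarrow> \<Gamma> \<turnstile>\<^sub>V V : \<delta> \<rightarrow>\<^sub>V \<tau>'"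
  by (blast intro: SubV arrow reflV)

lemma lowerV2: "\<delta> \<and>\<^sub>V \<delta>' \<le>\<^sub>V \<delta>'"
  by (blast intro: transV commV lowerV)

text \<open>Several derivations for the same bind may use different \<delta>; intersecting these
  gives a single witness. The first disjunct accounts for \<open>OmegaC\<close> and everything above
  it.\<close>

lemma type_Bind:
  assumes "\<Gamma> \<turnstile>\<^sub>C M \<star> V : \<tau>"
  shows "\<omega>\<^sub>C \<le>\<^sub>C \<tau> \<or> (\<exists>\<delta>. \<Gamma> \<turnstile>\<^sub>C M : T \<delta> \<and> \<Gamma> \<turnstile>\<^sub>V V : \<delta> \<rightarrow>\<^sub>V \<tau>)"
  using assms
proof (induction \<Gamma> "M \<star> V" \<tau>
    rule: type_val_type_cmp.inducts(2)[where ?P1.0 = "\<lambda>_ _ _. True"])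
  case (InterCI \<Gamma> \<tau> \<tau>')
  consider (both) "\<omega>\<^sub>C \<le>\<^sub>C \<tau>" "\<omega>\<^sub>C \<le>\<^sub>C \<tau>'"
    | (left) \<delta> where "\<Gamma> \<turnstile>\<^sub>C M : T \<delta>" "\<Gamma> \<turnstile>\<^sub>V V : \<delta> \<rightarrow>\<^sub>V \<tau>" "\<omega>\<^sub>C \<le>\<^sub>C \<tau>'"
    | (right) \<delta> where "\<Gamma> \<turnstile>\<^sub>C M : T \<delta>" "\<Gamma> \<turnstile>\<^sub>V V : \<delta> \<rightarrow>\<^sub>V \<tau>'" "\<omega>\<^sub>C \<le>\<^sub>C \<tau>"
    | (neither) \<delta> \<delta>' where "\<Gamma> \<turnstile>\<^sub>C M : T \<delta>" "\<Gamma> \<turnstile>\<^sub>V V : \<delta> \<rightarrow>\<^sub>V \<tau>"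
        "\<Gamma> \<turnstile>\<^sub>C M : T \<delta>'" "\<Gamma> \<turnstile>\<^sub>V V : \<delta>' \<rightarrow>\<^sub>V \<tau>'"
    using InterCI.hyps by blast
  then show ?case
  proof cases
    case both
    then show ?thesis by (blast intro: greatestC)
  next
    case left
    \<comment> \<open>A component above \<open>\<omega>\<^sub>C\<close> is above every type, so the
      intersection is equivalent to the other component and the witness \<delta> is kept.\<close>
    then have "\<tau> \<le>\<^sub>C \<tau> \<and>\<^sub>C \<tau>'" by (blast intro: greatestC reflC transC topC)
    with left show ?thesis by (blast intro: arrow_mono_right)
  next
    case right
    then have "\<tau>' \<le>\<^sub>C \<tau> \<and>\<^sub>C \<tau>'" by (blast intro: greatestC reflC transC topC)
    with right show ?thesis by (blast intro: arrow_mono_right)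
  next
    case neither
    have "\<Gamma> \<turnstile>\<^sub>C M : T (\<delta> \<and>\<^sub>V \<delta>')"
      using neither by (blast intro: type_val_type_cmp.InterCI SubC inter_T)
    \<comment> \<open>By contravariance both arrows accept the intersected domain;
      \<open>inter_arrow\<close> then joins their codomains.\<close>
    moreover have "\<Gamma> \<turnstile>\<^sub>V V : \<delta> \<and>\<^sub>V \<delta>' \<rightarrow>\<^sub>V \<tau>"
      by (rule SubV[OF neither(2)]) (blast intro: arrow lowerV reflC)
    moreover have "\<Gamma> \<turnstile>\<^sub>V V : \<delta> \<and>\<^sub>V \<delta>' \<rightarrow>\<^sub>V \<tau>'"
      by (rule SubV[OF neither(4)]) (blast intro: arrow lowerV2 reflC)
    ultimately show ?thesis by (blast intro: InterVI SubV inter_arrow)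
  qed
next
  case (SubC \<Gamma> \<tau> \<tau>')
  then show ?case by (blast intro: transC arrow_mono_right)
qed (blast intro: reflC)+

lemma type_above_omega: "\<omega>\<^sub>C \<le>\<^sub>C \<tau> \<Longrightarrow> \<Gamma> \<turnstile>\<^sub>C M : \<tau>"
  by (blast intro: SubC OmegaC)

text \<open>Elimination form of \<open>type_Bind\<close>: in the degenerate disjunct \<tau> is a
  type of every computation, hence of \<open>N\<close>, so only the case with a witness \<delta>
  remains.\<close>

lemma type_Bind_transfer:
  assumes "\<Gamma> \<turnstile>\<^sub>C M \<star> V : \<tau>"
    and "\<And>\<delta>. \<Gamma> \<turnstile>\<^sub>C M : T \<delta> \<Longrightarrow> \<Gamma> \<turnstile>\<^sub>V V : \<delta> \<rightarrow>\<^sub>V \<tau> \<Longrightarrow> \<Gamma> \<turnstile>\<^sub>C N : \<tau>"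
  shows "\<Gamma> \<turnstile>\<^sub>C N : \<tau>"
  using type_Bind[OF assms(1)] assms(2) type_above_omega by blast

section \<open>Subject reduction\<close>

lemma contract_type:
  assumes "contract M N" "\<Gamma> \<turnstile>\<^sub>C M : \<tau>"
  shows "\<Gamma> \<turnstile>\<^sub>C N : \<tau>"
  using assms
proof cases
  case (beta V M')
  with assms(2) show ?thesis
    by (auto elim!: type_Bind_transfer simp: type_Unit_T type_Lam_Arrow intro: type_beta)
next
  case ident
  show ?thesis
  proof (rule type_Bind_transfer[OF assms(2)[unfolded ident]])
    fix \<delta> assume N: "\<Gamma> \<turnstile>\<^sub>C N : T \<delta>" and "\<Gamma> \<turnstile>\<^sub>V Lam (Unit (Var 0)) : \<delta> \<rightarrow>\<^sub>V \<tau>"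
    \<comment> \<open>The body \<open>Unit (Var 0)\<close> is typed with index \<open>0\<close>
      assigned \<delta>, so \<open>T \<delta>\<close> is below each of its types.\<close>
    then have "T \<delta> \<le>\<^sub>C \<tau>" by (auto simp: type_Lam_Arrow intro: type_Unit_Var)
    with N show "\<Gamma> \<turnstile>\<^sub>C N : \<tau>" by (rule SubC)
  qed
next
  case (assoc L M' N')
  show ?thesis
  proof (rule type_Bind_transfer[OF assms(2)[unfolded assoc(1)]])
    fix \<delta> assume LM: "\<Gamma> \<turnstile>\<^sub>C L \<star> Lam M' : T \<delta>" and "\<Gamma> \<turnstile>\<^sub>V Lam N' : \<delta> \<rightarrow>\<^sub>V \<tau>"
    then have N': "extend \<Gamma> \<delta> \<turnstile>\<^sub>C N' : \<tau>" by (simp add: type_Lam_Arrow)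
    \<comment> \<open>The inner bind has type \<open>T \<delta>\<close>, which is not above
      \<open>\<omega>\<^sub>C\<close>; this rules out the degenerate disjunct and yields types for
      \<open>L\<close> and \<open>M'\<close>.\<close>
    from type_Bind[OF LM] omega_not_le_T obtain \<delta>' where
      L: "\<Gamma> \<turnstile>\<^sub>C L : T \<delta>'" and M': "extend \<Gamma> \<delta>' \<turnstile>\<^sub>C M' : T \<delta>"
      by (auto simp: type_Lam_Arrow)
    \<comment> \<open>Index \<open>1\<close> now refers to the binder of \<open>M'\<close>, of type
      \<open>\<delta>'\<close>, and the lifting from \<open>1\<close> skips it.\<close>
    from N' have "extend (extend \<Gamma> \<delta>') \<delta> \<turnstile>\<^sub>C lift_cmp 1 N' : \<tau>"
    proof (rule type_lift(2))
      fix i \<sigma> assume "extend \<Gamma> \<delta> i = Some \<sigma>"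
      then show "extend (extend \<Gamma> \<delta>') \<delta> (if i < 1 then i else Suc i) = Some \<sigma>"
        by (cases i) auto
    qed
    with L M' show "\<Gamma> \<turnstile>\<^sub>C N : \<tau>" unfolding assoc(2) by (blast intro: ArrowE ArrowI)
  qed
qed

text \<open>Used with \<open>P\<close> and \<open>Q\<close> as typability of the body before and
  after a reduction step.\<close>

lemma lam_has_weaken: "lam_has P \<delta> \<Longrightarrow> (\<And>\<sigma> \<tau>. P \<sigma> \<tau> \<Longrightarrow> Q \<sigma> \<tau>) \<Longrightarrow> lam_has Q \<delta>"
  by (induction \<delta> rule: vty.induct[where ?P2.0 = "\<lambda>_. True"]) auto

lemma unit_has_weaken: "unit_has P \<tau> \<Longrightarrow> (\<And>\<sigma>. P \<sigma> \<Longrightarrow> Q \<sigma>) \<Longrightarrow> unit_has Q \<tau>"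
  by (induction \<tau> rule: cty.induct[where ?P1.0 = "\<lambda>_. True"]) auto

text \<open>Induction on the reduction, with \<Gamma> arbitrary because a step below a binder is
  typed in an extended basis. The generation lemmas carry each component's new typing back to the
  whole term.\<close>

lemma subject_reduction:
  "V \<longrightarrow>\<^sub>V W \<Longrightarrow> \<Gamma> \<turnstile>\<^sub>V V : \<delta> \<Longrightarrow> \<Gamma> \<turnstile>\<^sub>V W : \<delta>"
  "M \<longrightarrow>\<^sub>C N \<Longrightarrow> \<Gamma> \<turnstile>\<^sub>C M : \<tau> \<Longrightarrow> \<Gamma> \<turnstile>\<^sub>C N : \<tau>"
proof (induction arbitrary: \<Gamma> \<delta> and \<Gamma> \<tau> rule: red_val_red_cmp.inducts)
  case (Contract M N)
  then show ?case by (rule contract_type)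
next
  case (Lam M N)
  then show ?case unfolding type_Lam_iff by (blast intro: lam_has_weaken)
next
  case (Unit V W)
  then show ?case unfolding type_Unit_iff by (blast intro: unit_has_weaken)
next
  case (BindL M N V)
  then show ?case by (blast intro: type_Bind_transfer ArrowE)
next
  case (BindR V W M)
  then show ?case by (blast intro: type_Bind_transfer ArrowE)
qed

theorem mainTheorem3:
  fixes \<Gamma> :: "nat \<rightharpoonup> 'a vty" and M N :: cmp and \<tau> :: "'a cty"
  assumes "basis \<Gamma>" and "\<Gamma> \<turnstile>\<^sub>C M : \<tau>" and "M \<longrightarrow>\<^sub>C N"
  shows "\<Gamma> \<turnstile>\<^sub>C N : \<tau>"
  using subject_reduction(2)[OF assms(3,2)] .

end
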